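(* Assume $N\ge2$ and that, for each $k=0,\dots,N-1$: $\mathbb{P}(X(k)\in\mathcal{X})=1$, $\mathbb{E}[X(k)\mid\mathcal{F}_k]=\mu$ almost surely for a fixed $\mu\in\mathbb{R}^m$, and $X(k)$ is independent of $\mathcal{F}_k$. Assume also that $h(u)>0$ for every $u\in\mathbb{R}^m\setminus\{\mathbf{0}\}$. Fix $d_{\max}\in[0,1)$ and $K\in\mathcal{K}$ satisfying $$h(K)\le 1-(1-d_{\max})^{1/N}.$$ For this drawdown limit, let $J_0$ denote the stage-$0$ Bellman value function and let $\pi^\star$ be an optimal drawdown-modulated policy (as defined in the context). Then $$\mathbb{E}[R_{\pi^\star}]=J_0(1)-1\ \ge\ \mathbb{E}[R_K].$$ The inequality is strict whenever $K^\top\mu-\varepsilon^\top|K|>0$.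
   Context: Fix $N$, $m\ge1$, $V_0>0$, a cost vector $\varepsilon\in\mathbb{R}_+^m$ (componentwise nonnegative), a nonempty compact set $\mathcal{X}\subset\mathbb{R}^m$ (time-invariant return support), and random vectors $X(0),\dots,X(N-1)$ in $\mathbb{R}^m$. $\mathcal{F}_0$ is trivial and $\mathcal{F}_k:=\sigma(X(0),\dots,X(k-1))$. $|u|$ is the vector of componentwise absolute values; $\sigma_{\mathcal{X}}(z):=\sup_{x\in\mathcal{X}}z^\top x$. $h(u):=\sigma_{\mathcal{X}}(-u)+\varepsilon^\top|u|$ and $\Gamma:=\{\gamma\in\mathbb{R}^m:h(\gamma)\le1\}$. The admissible feedback gain set is $\mathcal{K}:=\{K\in\mathbb{R}^m:\sigma_{\mathcal{X}}(-K)+\varepsilon^\top|K|\le1\}$. Account dynamics under a control $u(k)$: $V(k+1)=V(k)+u(k)^\top X(k)-\varepsilon^\top|u(k)|$, $V(0)=V_0$, and $V_{\max}(k)=\max_{0\le i\le k}V(i)$. For a policy $\pi$ with account value $V_\pi$, $R_\pi:=(V_\pi(N)-V_0)/V_0$. LTI policy with gain $K$: $u_K(k)=KV_K(k)$, so $V_K(k+1)=(1+K^\top X(k)-\varepsilon^\top|K|)V_K(k)$, $V_K(0)=V_0$; its return is $R_K:=(V_K(N)-V_0)/V_0$. Bellman recursion: for $z\in[1-d_{\max},1]$, $\gamma\in\Gamma$, $x\in\mathcal{X}$ let $\widehat v^+(z,\gamma,x):=z+[z-(1-d_{\max})](\gamma^\top x-\varepsilon^\top|\gamma|)$, $\widehat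 w^+(z,\gamma,x):=\max\{1,\widehat v^+(z,\gamma,x)\}$, $z^+(z,\gamma,x):=\widehat v^+(z,\gamma,x)/\widehat w^+(z,\gamma,x)\in[1-d_{\max},1]$. Set $J_N(z):=z$ and, for $k=N-1,\dots,0$, $$J_k(z):=\sup_{\gamma\in\Gamma}\mathbb{E}\Bigl[\widehat w^+\bigl(z,\gamma,X(k)\bigr)J_{k+1}\bigl(z^+(z,\gamma,X(k))\bigr)\Bigr].$$ Optimal drawdown-modulated policy $\pi^\star$: the policy given by the feedback law $u^{\pi^\star}(k)=V_{\max}(k)[z(k)-(1-d_{\max})]\gamma_k^\star(z(k))$, $z(k)=V(k)/V_{\max}(k)$, where $\gamma_k^\star:[1-d_{\max},1]\to\Gamma$ are Borel-measurable functions such that $\gamma_k^\star(z)$ attains the supremum defining $J_k(z)$ for every $z\in[1-d_{\max},1]$ (such functions exist under the assumptions of the claim). *)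

theory Defs
  imports "HOL-Probability.Probability"
begin

text \<open>Throughout, \<open>\<bar>u\<bar>\<close> on \<open>real ^ 'm\<close> is the library's componentwise absolute value.\<close>

definition support_fun :: "(real ^ 'm) set \<Rightarrow> real ^ 'm \<Rightarrow> real" where
  "support_fun S z = (SUP x\<in>S. z \<bullet> x)"

definition worst_loss :: "(real ^ 'm) set \<Rightarrow> real ^ 'm \<Rightarrow> real ^ 'm \<Rightarrow> real" where
  "worst_loss S \<epsilon> u = support_fun S (- u) + \<epsilon> \<bullet> \<bar>u\<bar>"

definition modulation_set :: "(real ^ 'm) set \<Rightarrow> real ^ 'm \<Rightarrow> (real ^ 'm) set" where
  "modulation_set S \<epsilon> = {\<gamma>. worst_loss S \<epsilon> \<gamma> \<le> 1}"

definition admissible_gains :: "(real ^ 'm) set \<Rightarrow> real ^ 'm \<Rightarrow> (real ^ 'm) set" where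
  "admissible_gains S \<epsilon> = {K. support_fun S (- K) + \<epsilon> \<bullet> \<bar>K\<bar> \<le> 1}"

text \<open>The \<open>\<sigma>\<close>-algebra generated by \<open>X 0, \<dots>, X (k - 1)\<close>; there are no generators for \<open>k = 0\<close>,
  which gives the trivial \<open>\<sigma>\<close>-algebra.\<close>

definition past :: "'a measure \<Rightarrow> (nat \<Rightarrow> 'a \<Rightarrow> real ^ 'm) \<Rightarrow> nat \<Rightarrow> 'a measure" where
  "past M X k = sigma (space M) (\<Union>i<k. {X i -` A \<inter> space M | A. A \<in> sets borel})"

text \<open>\<open>account u \<epsilon> V\<^sub>0 x k\<close> is the account value \<open>V(k)\<close> along the return path \<open>x\<close> under the
  feedback law \<open>u\<close>, whose arguments are the stage \<open>k\<close>, the current value \<open>V(k)\<close> and the running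
  maximum of \<open>V(0), \<dots>, V(k)\<close>.\<close>

fun account ::
  "(nat \<Rightarrow> real \<Rightarrow> real \<Rightarrow> real ^ 'm) \<Rightarrow> real ^ 'm \<Rightarrow> real \<Rightarrow> (nat \<Rightarrow> real ^ 'm) \<Rightarrow> nat \<Rightarrow> real"
where
  "account u \<epsilon> V\<^sub>0 x 0 = V\<^sub>0"
| "account u \<epsilon> V\<^sub>0 x (Suc k) =
    (let v = account u \<epsilon> V\<^sub>0 x k;
         v_max = Max ((\<lambda>i. account u \<epsilon> V\<^sub>0 x i) ` {..k});
         c = u k v v_max
     in v + c \<bullet> x k - \<epsilon> \<bullet> \<bar>c\<bar>)"

definition account_return ::
  "(nat \<Rightarrow> real \<Rightarrow> real \<Rightarrow> real ^ 'm) \<Rightarrow> real ^ 'm \<Rightarrow> real \<Rightarrow> nat \<Rightarrow> (nat \<Rightarrow> 'a \<Rightarrow> real ^ 'm) \<Rightarrow> 'a \<Rightarrow> real"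
where
  "account_return u \<epsilon> V\<^sub>0 N X \<omega> = (account u \<epsilon> V\<^sub>0 (\<lambda>k. X k \<omega>) N - V\<^sub>0) / V\<^sub>0"

definition lti_policy :: "real ^ 'm \<Rightarrow> nat \<Rightarrow> real \<Rightarrow> real \<Rightarrow> real ^ 'm" where
  "lti_policy K k v v_max = v *\<^sub>R K"

text \<open>The functions \<open>\<gamma> k\<close> only matter on \<open>{1 - d..1}\<close>, where \<open>v / v_max\<close> lies almost surely.
  On the remaining null event the control is set to \<open>0\<close>, so that the arbitrary values of \<open>\<gamma> k\<close>
  outside this interval cannot affect the measurability of the account value.\<close>

definition modulated_policy ::
  "real \<Rightarrow> (nat \<Rightarrow> real \<Rightarrow> real ^ 'm) \<Rightarrow> nat \<Rightarrow> real \<Rightarrow> real \<Rightarrow> real ^ 'm"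
where
  "modulated_policy d \<gamma> k v v_max =
    (let z = v / v_max
     in if z \<in> {1 - d..1} then (v_max * (z - (1 - d))) *\<^sub>R \<gamma> k z else 0)"

definition v_next :: "real \<Rightarrow> real ^ 'm \<Rightarrow> real \<Rightarrow> real ^ 'm \<Rightarrow> real ^ 'm \<Rightarrow> real" where
  "v_next d \<epsilon> z \<gamma> x = z + (z - (1 - d)) * (\<gamma> \<bullet> x - \<epsilon> \<bullet> \<bar>\<gamma>\<bar>)"

definition w_next :: "real \<Rightarrow> real ^ 'm \<Rightarrow> real \<Rightarrow> real ^ 'm \<Rightarrow> real ^ 'm \<Rightarrow> real" where
  "w_next d \<epsilon> z \<gamma> x = max 1 (v_next d \<epsilon> z \<gamma> x)"

definition z_next :: "real \<Rightarrow> real ^ 'm \<Rightarrow> real \<Rightarrow> real ^ 'm \<Rightarrow> real ^ 'm \<Rightarrow> real" where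
  "z_next d \<epsilon> z \<gamma> x = v_next d \<epsilon> z \<gamma> x / w_next d \<epsilon> z \<gamma> x"

definition stage_value ::
  "'a measure \<Rightarrow> real \<Rightarrow> real ^ 'm \<Rightarrow> ('a \<Rightarrow> real ^ 'm) \<Rightarrow> (real \<Rightarrow> real) \<Rightarrow> real \<Rightarrow> real ^ 'm \<Rightarrow> real"
where
  "stage_value M d \<epsilon> Y J z \<gamma> = (\<integral>\<omega>. w_next d \<epsilon> z \<gamma> (Y \<omega>) * J (z_next d \<epsilon> z \<gamma> (Y \<omega>)) \<partial>M)"

text \<open>The backward recursion is evaluated at every real \<open>z\<close>, but its values on \<open>{1 - d..1}\<close> do not
  depend on those elsewhere: \<open>z_next d \<epsilon> z \<gamma> x\<close> stays in this interval for \<open>z\<close> in it,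
  \<open>\<gamma>\<close> in \<open>modulation_set S \<epsilon>\<close> and \<open>x \<in> S\<close>.\<close>

function bellman ::
  "'a measure \<Rightarrow> (real ^ 'm) set \<Rightarrow> real \<Rightarrow> real ^ 'm \<Rightarrow> (nat \<Rightarrow> 'a \<Rightarrow> real ^ 'm) \<Rightarrow> nat \<Rightarrow> nat \<Rightarrow> real \<Rightarrow> real"
where
  "bellman M S d \<epsilon> X N k =
    (if k < N
     then (\<lambda>z. SUP \<gamma>\<in>modulation_set S \<epsilon>. stage_value M d \<epsilon> (X k) (bellman M S d \<epsilon> X N (Suc k)) z \<gamma>)
     else (\<lambda>z. z))"
  by pat_completeness auto
termination
  by (relation "Wellfounded.measure (\<lambda>(M, S, d, \<epsilon>, X, N, k). N - k)") auto

declare bellman.simps [simp del]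

definition optimal_modulation ::
  "'a measure \<Rightarrow> (real ^ 'm) set \<Rightarrow> real \<Rightarrow> real ^ 'm \<Rightarrow> (nat \<Rightarrow> 'a \<Rightarrow> real ^ 'm) \<Rightarrow> nat \<Rightarrow>
    (nat \<Rightarrow> real \<Rightarrow> real ^ 'm) \<Rightarrow> bool"
where
  "optimal_modulation M S d \<epsilon> X N \<gamma> \<longleftrightarrow>
    (\<forall>k<N. \<gamma> k \<in> borel_measurable (restrict_space borel {1 - d..1}) \<and>
      (\<forall>z\<in>{1 - d..1}. \<gamma> k z \<in> modulation_set S \<epsilon> \<and>
        stage_value M d \<epsilon> (X k) (bellman M S d \<epsilon> X N (Suc k)) z (\<gamma> k z) = bellman M S d \<epsilon> X N k z))"

end

theory Submission
  imports Defs
begin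

text \<open>Along an optimal policy, independence makes the expectation of \<open>V_max(k) J\<^sub>k(z(k))\<close> constant
  in \<open>k\<close>, whence the equality. The expected LTI return is \<open>(1 + c)\<^sup>N - 1\<close> with drift
  \<open>c = K \<bullet> \<mu> - \<epsilon> \<bullet> \<bar>K\<bar>\<close>. Write \<open>q = h(K)\<close>. An LTI path keeps \<open>z(k) \<ge> (1 - q)\<^sup>k\<close>, and as long as
  \<open>z (1 - q) \<ge> 1 - d\<close> the LTI control is itself drawdown modulated, so that by backward induction
  \<open>J\<^sub>k(z) \<ge> z (1 + c)\<^sup>N\<^sup>-\<^sup>k\<close> whenever \<open>z (1 - q)\<^sup>N\<^sup>-\<^sup>k \<ge> 1 - d\<close>. If \<open>c > 0\<close>, a larger gain is affordable
  at the last stage from \<open>z = 1\<close>, and this strict gain propagates backwards to \<open>J\<^sub>0(1)\<close>.\<close>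

section \<open>One-period net return and the Bellman integrand\<close>

definition net_return :: "real ^ 'm \<Rightarrow> real ^ 'm \<Rightarrow> real ^ 'm \<Rightarrow> real" where
  "net_return \<epsilon> u x = u \<bullet> x - \<epsilon> \<bullet> \<bar>u\<bar>"

text \<open>The Bellman integrand depends on state, gain and return only through the unnormalized
  next value \<open>v\<close>; this is that dependence. It agrees with \<open>J\<close> up to 1 and
  is linear with slope \<open>J 1\<close> above, where a new maximum resets the state to 1.\<close>

definition rescaled :: "(real \<Rightarrow> real) \<Rightarrow> real \<Rightarrow> real" where
  "rescaled J v = max 1 v * J (v / max 1 v)"

text \<open>Each member at \<open>x\<close> is at most the supremum at \<open>y\<close> plus
  \<open>L * dist x y\<close>, so a common constant survives the supremum. This serves both the
  support function and the value functions.\<close>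

lemma lipschitz_on_cSUP:
  fixes f :: "'i \<Rightarrow> 'b::metric_space \<Rightarrow> real"
  assumes "I \<noteq> {}" and L: "0 \<le> L"
    and lip: "\<And>i. i \<in> I \<Longrightarrow> L-lipschitz_on A (f i)"
    and bdd: "\<And>x. x \<in> A \<Longrightarrow> bdd_above ((\<lambda>i. f i x) ` I)"
  shows "L-lipschitz_on A (\<lambda>x. SUP i\<in>I. f i x)"
proof (rule lipschitz_onI[OF _ L])
  have le: "(SUP i\<in>I. f i x) \<le> (SUP i\<in>I. f i y) + L * dist x y" if "x \<in> A" "y \<in> A" for x y
  proof (rule cSUP_least[OF \<open>I \<noteq> {}\<close>])
    fix i assume i: "i \<in> I"
    have "f i x \<le> f i y + L * dist x y"
      using lipschitz_onD[OF lip[OF i] that] by (simp add: dist_real_def)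
    also have "f i y \<le> (SUP i\<in>I. f i y)"
      using bdd[OF that(2)] i by (rule cSUP_upper2) simp
    finally show "f i x \<le> (SUP i\<in>I. f i y) + L * dist x y" by simp
  qed
  show "dist (SUP i\<in>I. f i x) (SUP i\<in>I. f i y) \<le> L * dist x y" if "x \<in> A" "y \<in> A" for x y
    using le[of x y] le[of y x] that by (simp add: dist_real_def dist_commute)
qed

lemma abs_scaleR_vec: "\<bar>s *\<^sub>R u\<bar> = \<bar>s\<bar> *\<^sub>R \<bar>u\<bar>" for u :: "real ^ 'm"
  by (simp add: abs_vec_def vec_eq_iff abs_mult)

lemma continuous_on_abs_vec: "continuous_on A (\<lambda>u. \<bar>u\<bar>)" for A :: "(real ^ 'm) set"
  unfolding abs_vec_def by (intro continuous_intros)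

lemma borel_measurable_abs_vec: "(\<lambda>u :: real ^ 'm. \<bar>u\<bar>) \<in> borel_measurable borel"
  by (rule borel_measurable_continuous_onI, rule continuous_on_abs_vec)

lemma borel_measurable_net_return [measurable (raw)]:
  assumes [measurable]: "f \<in> borel_measurable M" "g \<in> borel_measurable M"
  shows "(\<lambda>\<omega>. net_return \<epsilon> (f \<omega>) (g \<omega>)) \<in> borel_measurable M"
proof -
  have [measurable]: "(\<lambda>\<omega>. \<bar>f \<omega>\<bar>) \<in> borel_measurable M"
    using measurable_compose[OF assms(1) borel_measurable_abs_vec] .
  show ?thesis unfolding net_return_def by measurable
qed

lemma net_return_0 [simp]: "net_return \<epsilon> 0 x = 0"
  by (simp add: net_return_def abs_vec_def inner_vec_def)

lemma net_return_scaleR: "0 \<le> s \<Longrightarrow> net_return \<epsilon> (s *\<^sub>R u) x = s * net_return \<epsilon> u x"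
  by (simp add: net_return_def abs_scaleR_vec algebra_simps)

lemma v_next_eq: "v_next d \<epsilon> z \<gamma> x = z + (z - (1 - d)) * net_return \<epsilon> \<gamma> x"
  by (simp add: v_next_def net_return_def)

lemma w_next_z_next: "w_next d \<epsilon> z \<gamma> x * J (z_next d \<epsilon> z \<gamma> x) = rescaled J (v_next d \<epsilon> z \<gamma> x)"
  by (simp add: w_next_def z_next_def rescaled_def)

lemma stage_value_eq:
  "stage_value M d \<epsilon> Y J z \<gamma> = (\<integral>\<omega>. rescaled J (v_next d \<epsilon> z \<gamma> (Y \<omega>)) \<partial>M)"
  by (simp add: stage_value_def w_next_z_next)

lemma rescaled_le_1: "v \<le> 1 \<Longrightarrow> rescaled J v = J v"
  by (simp add: rescaled_def)

lemma rescaled_ge_1: "1 \<le> v \<Longrightarrow> rescaled J v = v * J 1"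
  by (simp add: rescaled_def)

text \<open>Splitting at 1 gives \<open>J\<close> of the truncation \<open>min t 1\<close> plus
  \<open>J 1\<close> times the excess over 1. Both truncations are nonexpansive, which accounts for
  the two summands of the constant.\<close>

lemma lipschitz_on_rescaled:
  assumes "L-lipschitz_on UNIV J"
  shows "(L + \<bar>J 1\<bar>)-lipschitz_on UNIV (rescaled J)"
proof (rule lipschitz_onI)
  have L: "0 \<le> L" using assms by (rule lipschitz_on_nonneg)
  then show "0 \<le> L + \<bar>J 1\<bar>" by simp
  have J: "\<bar>J u - J v\<bar> \<le> L * \<bar>u - v\<bar>" for u v
    using lipschitz_onD[OF assms, of u v] by (simp add: dist_real_def)
  have le: "\<bar>rescaled J u - rescaled J v\<bar> \<le> (L + \<bar>J 1\<bar>) * \<bar>u - v\<bar>" if "u \<le> v" for u v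
  proof -
    have split: "rescaled J t = J (min t 1) + (max t 1 - 1) * J 1" for t
      by (cases "t \<le> 1") (simp_all add: rescaled_le_1 rescaled_ge_1 algebra_simps)
    have "rescaled J u - rescaled J v
        = (J (min u 1) - J (min v 1)) + (max u 1 - max v 1) * J 1"
      unfolding split[of u] split[of v] by (simp add: algebra_simps)
    also have "\<bar>\<dots>\<bar> \<le> \<bar>J (min u 1) - J (min v 1)\<bar> + \<bar>(max u 1 - max v 1) * J 1\<bar>"
      by (rule abs_triangle_ineq)
    also have "\<dots> \<le> L * \<bar>min u 1 - min v 1\<bar> + \<bar>max u 1 - max v 1\<bar> * \<bar>J 1\<bar>"
      using J[of "min u 1" "min v 1"] by (simp add: abs_mult)
    also have "\<dots> \<le> L * \<bar>u - v\<bar> + \<bar>u - v\<bar> * \<bar>J 1\<bar>"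
      using L by (intro add_mono mult_left_mono mult_right_mono) auto
    finally show ?thesis by (simp add: algebra_simps)
  qed
  show "dist (rescaled J u) (rescaled J v) \<le> (L + \<bar>J 1\<bar>) * dist u v" for u v
    using le[of u v] le[of v u] by (cases "u \<le> v") (auto simp: dist_real_def abs_minus_commute)
qed

section \<open>Support function, worst loss and boundedness of the modulation set\<close>

lemma support_fun_upper:
  assumes "compact S" "x \<in> S"
  shows "z \<bullet> x \<le> support_fun S z"
proof -
  have "compact ((\<lambda>x. z \<bullet> x) ` S)"
    by (intro compact_continuous_image continuous_intros assms)
  then have "bdd_above ((\<lambda>x. z \<bullet> x) ` S)"
    by (intro bounded_imp_bdd_above compact_imp_bounded)
  then show ?thesis unfolding support_fun_def using assms(2) by (rule cSUP_upper2) simp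
qed

lemma support_fun_least: "S \<noteq> {} \<Longrightarrow> (\<And>x. x \<in> S \<Longrightarrow> z \<bullet> x \<le> c) \<Longrightarrow> support_fun S z \<le> c"
  unfolding support_fun_def by (rule cSUP_least)

lemma support_fun_scaleR:
  assumes S: "compact S" "S \<noteq> {}" and "0 \<le> s"
  shows "support_fun S (s *\<^sub>R z) = s * support_fun S z"
proof -
  have le: "support_fun S (s *\<^sub>R z) \<le> s * support_fun S z" if "0 \<le> s" for s z
    using that by (intro support_fun_least S) (simp add: support_fun_upper[OF S(1)] mult_left_mono)
  show ?thesis
  proof (cases "s = 0")
    case True
    then show ?thesis using S by (simp add: support_fun_def)
  next
    case False
    with \<open>0 \<le> s\<close> have "0 < s" by simp
    \<comment> \<open>The reverse inequality is the first one for the scale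
      \<open>inverse s\<close>, applied to the vector already scaled by \<open>s\<close>.\<close>
    then have "s * support_fun S z \<le> support_fun S (s *\<^sub>R z)"
      using le[of "inverse s" "s *\<^sub>R z"] by (simp add: field_simps)
    with le[of s z] \<open>0 \<le> s\<close> show ?thesis by simp
  qed
qed

lemma worst_loss_scaleR:
  assumes "compact S" "S \<noteq> {}" "0 \<le> s"
  shows "worst_loss S \<epsilon> (s *\<^sub>R u) = s * worst_loss S \<epsilon> u"
  using support_fun_scaleR[OF assms, of "- u"] assms(3)
  by (simp add: worst_loss_def abs_scaleR_vec distrib_left)

lemma worst_loss_0: "compact S \<Longrightarrow> S \<noteq> {} \<Longrightarrow> worst_loss S \<epsilon> 0 = 0"
  using worst_loss_scaleR[of S 0] by simp

lemma net_return_ge: "compact S \<Longrightarrow> x \<in> S \<Longrightarrow> - worst_loss S \<epsilon> u \<le> net_return \<epsilon> u x"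
  using support_fun_upper[of S x "- u"] by (simp add: worst_loss_def net_return_def)

lemma continuous_on_support_fun:
  assumes "compact S" "S \<noteq> {}"
  shows "continuous_on A (support_fun S)"
proof -
  obtain R where R: "0 < R" "\<And>x. x \<in> S \<Longrightarrow> norm x \<le> R"
    using compact_imp_bounded[OF assms(1)] unfolding bounded_pos by blast
  have "R-lipschitz_on A (\<lambda>z. SUP x\<in>S. z \<bullet> x)"
  proof (rule lipschitz_on_cSUP)
    show "R-lipschitz_on A (\<lambda>z. z \<bullet> x)" if "x \<in> S" for x
    proof (rule lipschitz_onI)
      fix y z :: "real ^ 'a"
      have "dist (y \<bullet> x) (z \<bullet> x) \<le> norm (y - z) * norm x"
        by (simp add: dist_real_def inner_diff_left[symmetric] Cauchy_Schwarz_ineq2)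
      also have "\<dots> \<le> norm (y - z) * R" using R(2)[OF that] by (intro mult_left_mono) auto
      finally show "dist (y \<bullet> x) (z \<bullet> x) \<le> R * dist y z" by (simp add: dist_norm mult.commute)
    qed (use R in simp)
    show "bdd_above ((\<lambda>x. z \<bullet> x) ` S)" for z
      using support_fun_upper[OF assms(1)] by (intro bdd_aboveI2)
  qed (use R assms in auto)
  then show ?thesis unfolding support_fun_def[abs_def] by (rule lipschitz_on_continuous_on)
qed

lemma continuous_on_worst_loss:
  assumes "compact S" "S \<noteq> {}"
  shows "continuous_on A (worst_loss S \<epsilon>)"
  unfolding worst_loss_def[abs_def]
  by (intro continuous_intros continuous_on_abs_vec
      continuous_on_compose2[OF continuous_on_support_fun[OF assms, of UNIV]]) auto

text \<open>By compactness of the unit sphere, \<open>worst_loss\<close> has a positive minimum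
  \<open>?c\<close> there. By homogeneity it is then at least \<open>?c\<close> times the norm, so
  its sublevel set at 1 lies in the ball of radius \<open>1 / ?c\<close>.\<close>

lemma bounded_modulation_set:
  fixes S :: "(real ^ 'm) set"
  assumes S: "compact S" "S \<noteq> {}" and pos: "\<And>u. u \<noteq> 0 \<Longrightarrow> worst_loss S \<epsilon> u > 0"
  shows "bounded (modulation_set S \<epsilon>)"
proof -
  have "sphere (0 :: real ^ 'm) 1 \<noteq> {}" by simp
  then obtain e where e: "e \<in> sphere 0 1"
    "\<And>u. u \<in> sphere 0 1 \<Longrightarrow> worst_loss S \<epsilon> e \<le> worst_loss S \<epsilon> u"
    using continuous_attains_inf[OF compact_sphere _ continuous_on_worst_loss[OF S]] by metis
  let ?c = "worst_loss S \<epsilon> e"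
  have c: "0 < ?c" using e(1) by (intro pos) auto
  have "norm \<gamma> \<le> 1 / ?c" if "\<gamma> \<in> modulation_set S \<epsilon>" for \<gamma>
  proof (cases "\<gamma> = 0")
    case False
    have "?c * norm \<gamma> \<le> norm \<gamma> * worst_loss S \<epsilon> (inverse (norm \<gamma>) *\<^sub>R \<gamma>)"
      using e(2)[of "inverse (norm \<gamma>) *\<^sub>R \<gamma>"] False by (simp add: mult.commute mult_left_mono)
    also have "\<dots> = worst_loss S \<epsilon> \<gamma>"
      using False by (simp add: worst_loss_scaleR[OF S])
    also have "\<dots> \<le> 1" using that by (simp add: modulation_set_def)
    finally show ?thesis using c by (simp add: field_simps)
  qed (use c in simp)
  then show ?thesis by (auto simp: bounded_iff)
qed

lemma net_return_bounded:
  assumes "compact S" "bounded G"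
  obtains B where "0 \<le> B" "\<And>\<gamma> x. \<gamma> \<in> G \<Longrightarrow> x \<in> S \<Longrightarrow> \<bar>net_return \<epsilon> \<gamma> x\<bar> \<le> B"
proof -
  \<comment> \<open>\<open>G\<close> is only assumed bounded, so the closure supplies the
    compactness.\<close>
  have "compact (closure G \<times> S)" using assms by (intro compact_Times) (auto simp: compact_closure)
  then have "compact ((\<lambda>(\<gamma>, x). net_return \<epsilon> \<gamma> x) ` (closure G \<times> S))"
    unfolding net_return_def split_def
    by (rule compact_continuous_image[rotated])
      (intro continuous_intros continuous_on_compose2[OF continuous_on_abs_vec[of UNIV]], auto)
  then have "bounded ((\<lambda>(\<gamma>, x). net_return \<epsilon> \<gamma> x) ` (closure G \<times> S))"
    by (rule compact_imp_bounded)
  then obtain B where B: "0 < B" "\<forall>\<gamma>\<in>closure G. \<forall>x\<in>S. \<bar>net_return \<epsilon> \<gamma> x\<bar> \<le> B"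
    unfolding bounded_pos by auto
  then show ?thesis using that[of B] closure_subset[of G] by (simp add: subset_iff)
qed

section \<open>Account recursion, running maximum and adaptedness\<close>

definition running_max ::
  "(nat \<Rightarrow> real \<Rightarrow> real \<Rightarrow> real ^ 'm) \<Rightarrow> real ^ 'm \<Rightarrow> real \<Rightarrow> (nat \<Rightarrow> real ^ 'm) \<Rightarrow> nat \<Rightarrow> real"
where
  "running_max u \<epsilon> V\<^sub>0 x k = Max (account u \<epsilon> V\<^sub>0 x ` {..k})"

lemma running_max_0: "running_max u \<epsilon> V\<^sub>0 x 0 = V\<^sub>0"
  by (simp add: running_max_def)

lemma running_max_Suc:
  "running_max u \<epsilon> V\<^sub>0 x (Suc k) = max (running_max u \<epsilon> V\<^sub>0 x k) (account u \<epsilon> V\<^sub>0 x (Suc k))"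
  unfolding running_max_def atMost_Suc image_insert by (subst Max_insert) (auto simp: max.commute)

lemma account_Suc:
  "account u \<epsilon> V\<^sub>0 x (Suc k) = account u \<epsilon> V\<^sub>0 x k +
    net_return \<epsilon> (u k (account u \<epsilon> V\<^sub>0 x k) (running_max u \<epsilon> V\<^sub>0 x k)) (x k)"
  by (simp add: Let_def net_return_def running_max_def)

declare account.simps(2) [simp del]

lemma space_past: "space (past M X k) = space M"
  by (simp add: past_def space_measure_of_conv)

lemma sets_past:
  "sets (past M X k) = sigma_sets (space M) (\<Union>i<k. {X i -` A \<inter> space M | A. A \<in> sets borel})"
  unfolding past_def by (rule sets_measure_of) auto

lemma measurable_past: "i < k \<Longrightarrow> X i \<in> borel_measurable (past M X k)"
  by (rule measurableI) (auto simp: space_past sets_past intro!: sigma_sets.Basic)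

lemma sets_past_mono: "j \<le> k \<Longrightarrow> sets (past M X j) \<subseteq> sets (past M X k)"
  unfolding sets_past by (intro sigma_sets_mono' UN_mono) auto

lemma measurable_past_mono: "f \<in> measurable (past M X j) T \<Longrightarrow> j \<le> k \<Longrightarrow> f \<in> measurable (past M X k) T"
  using sets_past_mono[of j k M X] by (auto simp: measurable_def space_past)

lemma subalgebra_past:
  assumes "\<And>i. i < k \<Longrightarrow> X i \<in> borel_measurable M"
  shows "subalgebra M (past M X k)"
  unfolding subalgebra_def sets_past space_past
  using assms by (auto intro!: sets.sigma_sets_subset measurable_sets)

text \<open>Stage \<open>k\<close> of the account reads only the returns before \<open>k\<close>;
  this is what later makes the state independent of \<open>X k\<close>. Value and maximum are
  carried together because the feedback law reads both.\<close>

lemma measurable_account: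
  assumes u: "\<And>j. j < n \<Longrightarrow> (\<lambda>(v, v_max). u j v v_max) \<in> borel_measurable (borel \<Otimes>\<^sub>M borel)"
    and "k \<le> n"
  shows "(\<lambda>\<omega>. account u \<epsilon> V\<^sub>0 (\<lambda>k. X k \<omega>) k) \<in> borel_measurable (past M X k) \<and>
    (\<lambda>\<omega>. running_max u \<epsilon> V\<^sub>0 (\<lambda>k. X k \<omega>) k) \<in> borel_measurable (past M X k)"
  using \<open>k \<le> n\<close>
proof (induction k)
  case 0
  show ?case by (simp add: running_max_0)
next
  case (Suc k)
  let ?V = "\<lambda>\<omega>. account u \<epsilon> V\<^sub>0 (\<lambda>k. X k \<omega>) k"
  let ?W = "\<lambda>\<omega>. running_max u \<epsilon> V\<^sub>0 (\<lambda>k. X k \<omega>) k"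
  have [measurable]: "?V \<in> borel_measurable (past M X (Suc k))" "?W \<in> borel_measurable (past M X (Suc k))"
    using Suc by (auto intro: measurable_past_mono[of _ _ _ k])
  have [measurable]: "X k \<in> borel_measurable (past M X (Suc k))" by (simp add: measurable_past)
  have "k < n" using Suc.prems by simp
  have [measurable]: "(\<lambda>\<omega>. u k (?V \<omega>) (?W \<omega>)) \<in> borel_measurable (past M X (Suc k))"
    using measurable_compose[OF measurable_Pair u[OF \<open>k < n\<close>], of ?V "past M X (Suc k)" ?W] by simp
  have [measurable]: "(\<lambda>\<omega>. account u \<epsilon> V\<^sub>0 (\<lambda>k. X k \<omega>) (Suc k)) \<in> borel_measurable (past M X (Suc k))"
    unfolding account_Suc by measurable
  show ?case unfolding running_max_Suc by measurable
qed

section \<open>The return model: bounds, means and independence\<close>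

locale return_model = prob_space M for M :: "'a measure" +
  fixes X :: "nat \<Rightarrow> 'a \<Rightarrow> real ^ 'm" and S :: "(real ^ 'm) set" and \<epsilon> \<mu> :: "real ^ 'm"
    and N :: nat and d :: real
  assumes compact_S: "compact S" and S_nonempty: "S \<noteq> {}"
    and measurable_X: "\<And>k. k < N \<Longrightarrow> X k \<in> borel_measurable M"
    and X_in_S: "\<And>k. k < N \<Longrightarrow> AE \<omega> in M. X k \<omega> \<in> S"
    and cond_exp_X: "\<And>k. k < N \<Longrightarrow>
      AE \<omega> in M. \<forall>i. real_cond_exp M (past M X k) (\<lambda>\<omega>. X k \<omega> $ i) \<omega> = \<mu> $ i"
    and indep_X: "\<And>k. k < N \<Longrightarrow>
      indep_set {X k -` A \<inter> space M | A. A \<in> sets borel} (sets (past M X k))"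
    and worst_loss_pos: "\<And>u. u \<noteq> 0 \<Longrightarrow> worst_loss S \<epsilon> u > 0"
    and d_nonneg: "0 \<le> d" and d_less_1: "d < 1"
begin

abbreviation J :: "nat \<Rightarrow> real \<Rightarrow> real" where "J k \<equiv> bellman M S d \<epsilon> X N k"
abbreviation \<Gamma> :: "(real ^ 'm) set" where "\<Gamma> \<equiv> modulation_set S \<epsilon>"
abbreviation drift :: "real ^ 'm \<Rightarrow> real" where "drift u \<equiv> net_return \<epsilon> u \<mu>"

lemma zero_mem_modulation_set: "0 \<in> \<Gamma>"
  by (simp add: modulation_set_def worst_loss_0 compact_S S_nonempty)

text \<open>Fixed by choice, so that all later growth, integrability and Lipschitz estimates share
  one bound on the net return.\<close>

definition B :: real where
  "B = (SOME B. 0 \<le> B \<and> (\<forall>\<gamma>\<in>\<Gamma>. \<forall>x\<in>S. \<bar>net_return \<epsilon> \<gamma> x\<bar> \<le> B))"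

lemma B_nonneg: "0 \<le> B" and net_return_le_B: "\<gamma> \<in> \<Gamma> \<Longrightarrow> x \<in> S \<Longrightarrow> \<bar>net_return \<epsilon> \<gamma> x\<bar> \<le> B"
proof -
  obtain b where b: "0 \<le> b" "\<And>\<gamma> x. \<gamma> \<in> \<Gamma> \<Longrightarrow> x \<in> S \<Longrightarrow> \<bar>net_return \<epsilon> \<gamma> x\<bar> \<le> b"
    using net_return_bounded[OF compact_S bounded_modulation_set[OF compact_S S_nonempty worst_loss_pos],
        of \<epsilon>] by blast
  have "\<exists>b. 0 \<le> b \<and> (\<forall>\<gamma>\<in>\<Gamma>. \<forall>x\<in>S. \<bar>net_return \<epsilon> \<gamma> x\<bar> \<le> b)"
    by (rule exI[of _ b]) (simp add: b)
  then have "0 \<le> B \<and> (\<forall>\<gamma>\<in>\<Gamma>. \<forall>x\<in>S. \<bar>net_return \<epsilon> \<gamma> x\<bar> \<le> B)"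
    unfolding B_def by (rule someI_ex)
  then show "0 \<le> B" and "\<gamma> \<in> \<Gamma> \<Longrightarrow> x \<in> S \<Longrightarrow> \<bar>net_return \<epsilon> \<gamma> x\<bar> \<le> B" by auto
qed

lemma net_return_ge_minus_1: "\<gamma> \<in> \<Gamma> \<Longrightarrow> x \<in> S \<Longrightarrow> -1 \<le> net_return \<epsilon> \<gamma> x"
  using net_return_ge[OF compact_S, of x \<epsilon> \<gamma>] by (simp add: modulation_set_def)

lemma integrable_X: "k < N \<Longrightarrow> integrable M (X k)"
proof -
  assume k: "k < N"
  obtain R where "\<And>x. x \<in> S \<Longrightarrow> norm x \<le> R"
    using compact_imp_bounded[OF compact_S] unfolding bounded_iff by auto
  then show ?thesis
    using X_in_S[OF k] measurable_X[OF k] by (intro integrable_const_bound[of _ R]) auto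
qed

text \<open>The conditional mean is integrated once more (tower property), coordinate by coordinate
  since \<open>real_cond_exp\<close> is real valued.\<close>

lemma expectation_X: "k < N \<Longrightarrow> expectation (X k) = \<mu>"
proof -
  assume k: "k < N"
  interpret finite_measure_subalgebra M "past M X k"
  proof unfold_locales
    show "subalgebra M (past M X k)" using k by (intro subalgebra_past measurable_X) simp
  qed
  have "expectation (X k) $ i = \<mu> $ i" for i
  proof -
    have comp: "X k \<omega> $ i = X k \<omega> \<bullet> axis i 1" for \<omega> by (simp add: inner_axis)
    have int: "integrable M (\<lambda>\<omega>. X k \<omega> $ i)"
      unfolding comp using integrable_X[OF k] by simp
    have "expectation (X k) $ i = expectation (\<lambda>\<omega>. X k \<omega> $ i)"
      using integral_inner_left[of "axis i 1" M "X k"] integrable_X[OF k] by (simp add: inner_axis)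
    also have "\<dots> = expectation (real_cond_exp M (past M X k) (\<lambda>\<omega>. X k \<omega> $ i))"
      using real_cond_exp_int(2)[OF int] by simp
    also have "\<dots> = expectation (\<lambda>\<omega>. \<mu> $ i)"
      using cond_exp_X[OF k]
      by (intro integral_cong_AE) (auto intro: borel_measurable_cond_exp2)
    finally show ?thesis by (simp add: prob_space)
  qed
  then show ?thesis by (simp add: vec_eq_iff)
qed

lemma integrable_net_return: "k < N \<Longrightarrow> integrable M (\<lambda>\<omega>. net_return \<epsilon> u (X k \<omega>))"
  unfolding net_return_def using integrable_X by simp

lemma expectation_net_return: "k < N \<Longrightarrow> expectation (\<lambda>\<omega>. net_return \<epsilon> u (X k \<omega>)) = drift u"
  unfolding net_return_def using integrable_X expectation_X by (simp add: prob_space)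

lemma expectation_v_next:
  assumes "k < N"
  shows "integrable M (\<lambda>\<omega>. v_next d \<epsilon> z \<gamma> (X k \<omega>))"
    and "expectation (\<lambda>\<omega>. v_next d \<epsilon> z \<gamma> (X k \<omega>)) = z + (z - (1 - d)) * drift \<gamma>"
  unfolding v_next_eq using integrable_net_return[OF assms] expectation_net_return[OF assms]
  by (simp_all add: prob_space)

text \<open>Independence makes the joint law of \<open>Y\<close> and \<open>X k\<close> a product,
  so by Fubini \<open>X k\<close> is integrated out with the past frozen. Both account recursions
  are evaluated in this way.\<close>

lemma expectation_past_X:
  fixes f :: "'b \<times> (real ^ 'm) \<Rightarrow> real"
  assumes k: "k < N" and Y: "Y \<in> measurable (past M X k) T"
    and f [measurable]: "f \<in> borel_measurable (T \<Otimes>\<^sub>M borel)"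
    and int: "integrable M (\<lambda>\<omega>. f (Y \<omega>, X k \<omega>))"
  shows "expectation (\<lambda>\<omega>. f (Y \<omega>, X k \<omega>)) = expectation (\<lambda>\<omega>'. expectation (\<lambda>\<omega>. f (Y \<omega>', X k \<omega>)))"
proof -
  have X [measurable]: "X k \<in> borel_measurable M" by (rule measurable_X[OF k])
  have sub: "subalgebra M (past M X k)"
    using k by (intro subalgebra_past measurable_X) simp
  have Y' [measurable]: "Y \<in> measurable M T"
    using measurable_from_subalg[OF sub Y] .
  interpret P: prob_space "distr M borel (X k)" by (rule prob_space_distr) simp
  interpret Q: prob_space "distr M T Y" by (rule prob_space_distr) simp
  interpret PQ: pair_sigma_finite "distr M T Y" "distr M borel (X k)" ..
  have prod: "distr M T Y \<Otimes>\<^sub>M distr M borel (X k) = distr M (T \<Otimes>\<^sub>M borel) (\<lambda>\<omega>. (Y \<omega>, X k \<omega>))"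
  proof (rule pair_measure_eqI)
    show "sigma_finite_measure (distr M T Y)" "sigma_finite_measure (distr M borel (X k))" ..
    show "sets (distr M T Y \<Otimes>\<^sub>M distr M borel (X k)) =
        sets (distr M (T \<Otimes>\<^sub>M borel) (\<lambda>\<omega>. (Y \<omega>, X k \<omega>)))"
      by (simp cong: sets_pair_measure_cong)
    fix A C assume "A \<in> sets (distr M T Y)" and "C \<in> sets (distr M borel (X k))"
    then have A [measurable]: "A \<in> sets T" and C [measurable]: "C \<in> sets borel" by simp_all
    \<comment> \<open>Preimages under \<open>Y\<close> lie in the \<sigma>-algebra of the past, so
      independence is exactly the product formula on rectangles, which determine the
      measure.\<close>
    have "prob ((X k -` C \<inter> space M) \<inter> (Y -` A \<inter> space M)) =
        prob (X k -` C \<inter> space M) * prob (Y -` A \<inter> space M)"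
      using C measurable_sets[OF Y A] by (intro indep_setD[OF indep_X[OF k]]) (auto simp: space_past)
    moreover have "(X k -` C \<inter> space M) \<inter> (Y -` A \<inter> space M) =
        (\<lambda>\<omega>. (Y \<omega>, X k \<omega>)) -` (A \<times> C) \<inter> space M"
      by auto
    ultimately show "emeasure (distr M T Y) A * emeasure (distr M borel (X k)) C =
        emeasure (distr M (T \<Otimes>\<^sub>M borel) (\<lambda>\<omega>. (Y \<omega>, X k \<omega>))) (A \<times> C)"
      by (simp add: emeasure_distr emeasure_eq_measure ennreal_mult'[symmetric] mult.commute)
  qed
  have intp: "integrable (distr M T Y \<Otimes>\<^sub>M distr M borel (X k)) f"
    unfolding prod by (subst integrable_distr_eq) (use int in simp_all)
  have "expectation (\<lambda>\<omega>. f (Y \<omega>, X k \<omega>)) = integral\<^sup>L (distr M T Y \<Otimes>\<^sub>M distr M borel (X k)) f"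
    unfolding prod by (subst integral_distr) simp_all
  also have "\<dots> = (\<integral>y. \<integral>x. f (y, x) \<partial>distr M borel (X k) \<partial>distr M T Y)"
    by (rule PQ.integral_fst'[OF intp, symmetric])
  also have "\<dots> = (\<integral>\<omega>'. \<integral>x. f (Y \<omega>', x) \<partial>distr M borel (X k) \<partial>M)"
    by (subst integral_distr) simp_all
  also have "\<dots> = (\<integral>\<omega>'. \<integral>\<omega>. f (Y \<omega>', X k \<omega>) \<partial>M \<partial>M)"
  proof (rule Bochner_Integration.integral_cong[OF refl])
    fix \<omega>' assume "\<omega>' \<in> space M"
    then have "Y \<omega>' \<in> space T" using Y' by (rule measurable_space[rotated])
    then have [measurable]: "(\<lambda>x. f (Y \<omega>', x)) \<in> borel_measurable borel"
      by (rule measurable_compose_Pair1[OF _ f])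
    show "(\<integral>x. f (Y \<omega>', x) \<partial>distr M borel (X k)) = (\<integral>\<omega>. f (Y \<omega>', X k \<omega>) \<partial>M)"
      by (rule integral_distr) simp_all
  qed
  finally show ?thesis .
qed

section \<open>Regularity of the Bellman value functions\<close>

lemma bellman_less: "k < N \<Longrightarrow> J k = (\<lambda>z. SUP \<gamma>\<in>\<Gamma>. stage_value M d \<epsilon> (X k) (J (Suc k)) z \<gamma>)"
  by (subst bellman.simps) simp

lemma bellman_N: "J N = (\<lambda>z. z)"
  by (subst bellman.simps) simp

lemma v_next_le:
  assumes "\<gamma> \<in> \<Gamma>" "x \<in> S"
  shows "\<bar>v_next d \<epsilon> z \<gamma> x\<bar> \<le> \<bar>z\<bar> + \<bar>z - (1 - d)\<bar> * B"
proof -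
  have "\<bar>(z - (1 - d)) * net_return \<epsilon> \<gamma> x\<bar> \<le> \<bar>z - (1 - d)\<bar> * B"
    using net_return_le_B[OF assms] by (simp add: abs_mult mult_left_mono)
  then show ?thesis unfolding v_next_eq by (rule order_trans[OF abs_triangle_ineq add_left_mono])
qed

text \<open>The value functions are Lipschitz on the whole line, not only on \<open>{1 - d..1}\<close>: off the event
  \<open>X k \<in> S\<close> the next state leaves that interval, and the Bochner integral of a nonmeasurable
  integrand would be \<open>0\<close>.\<close>

context
  fixes k :: nat and L :: real
  assumes k: "k < N" and lip: "L-lipschitz_on UNIV (J (Suc k))"
begin

private definition L' :: real where "L' = L + \<bar>J (Suc k) 1\<bar>"

text \<open>All three claims rest on bounds uniform in the gain: they make the integrand integrable,
  bound the stage values above so that the supremum really dominates them, and give all stage values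
  one Lipschitz constant.\<close>

lemma stage_integrand_integrable:
  "\<gamma> \<in> \<Gamma> \<Longrightarrow> integrable M (\<lambda>\<omega>. rescaled (J (Suc k)) (v_next d \<epsilon> z \<gamma> (X k \<omega>)))"
  and bellman_ge_stage_value:
  "\<gamma> \<in> \<Gamma> \<Longrightarrow> stage_value M d \<epsilon> (X k) (J (Suc k)) z \<gamma> \<le> J k z"
  and bellman_lipschitz_step: "\<exists>L. L-lipschitz_on UNIV (J k)"
proof -
  let ?G = "rescaled (J (Suc k))"
  have G: "L'-lipschitz_on UNIV ?G"
    unfolding L'_def by (rule lipschitz_on_rescaled[OF lip])
  have L': "0 \<le> L'" by (rule lipschitz_on_nonneg[OF G])
  have Gm [measurable]: "?G \<in> borel_measurable borel"
    by (rule borel_measurable_continuous_onI, rule lipschitz_on_continuous_on[OF G])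
  have Xm [measurable]: "X k \<in> borel_measurable M" by (rule measurable_X[OF k])
  \<comment> \<open>The value of the integrand at 0 plus its Lipschitz constant times the bound on
    \<open>v_next\<close>.\<close>
  define C where "C z = \<bar>?G 0\<bar> + L' * (\<bar>z\<bar> + \<bar>z - (1 - d)\<bar> * B)" for z
  have bound: "\<bar>?G (v_next d \<epsilon> z \<gamma> x)\<bar> \<le> C z" if "\<gamma> \<in> \<Gamma>" "x \<in> S" for z \<gamma> x
  proof -
    have "\<bar>?G (v_next d \<epsilon> z \<gamma> x) - ?G 0\<bar> \<le> L' * \<bar>v_next d \<epsilon> z \<gamma> x\<bar>"
      using lipschitz_onD[OF G, of "v_next d \<epsilon> z \<gamma> x" 0] by (simp add: dist_real_def)
    also have "\<dots> \<le> L' * (\<bar>z\<bar> + \<bar>z - (1 - d)\<bar> * B)"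
      using v_next_le[OF that] L' by (rule mult_left_mono)
    finally show ?thesis unfolding C_def by linarith
  qed
  have int: "integrable M (\<lambda>\<omega>. ?G (v_next d \<epsilon> z \<gamma> (X k \<omega>)))" if "\<gamma> \<in> \<Gamma>" for z \<gamma>
  proof (rule integrable_const_bound[of _ "C z"])
    show "AE \<omega> in M. norm (?G (v_next d \<epsilon> z \<gamma> (X k \<omega>))) \<le> C z"
      using X_in_S[OF k] by eventually_elim (simp add: bound that)
    show "(\<lambda>\<omega>. ?G (v_next d \<epsilon> z \<gamma> (X k \<omega>))) \<in> borel_measurable M"
      unfolding v_next_eq by measurable
  qed
  then show "\<gamma> \<in> \<Gamma> \<Longrightarrow> integrable M (\<lambda>\<omega>. ?G (v_next d \<epsilon> z \<gamma> (X k \<omega>)))" .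
  let ?V = "stage_value M d \<epsilon> (X k) (J (Suc k))"
  have "?V z \<gamma> \<le> C z" if "\<gamma> \<in> \<Gamma>" for z \<gamma>
    unfolding stage_value_eq
  proof (rule integral_le_const[OF int[OF that]])
    show "AE \<omega> in M. ?G (v_next d \<epsilon> z \<gamma> (X k \<omega>)) \<le> C z"
      using X_in_S[OF k] by eventually_elim (use bound[OF that] in \<open>auto simp: abs_le_iff\<close>)
  qed
  then have bdd: "bdd_above (?V z ` \<Gamma>)" for z by (intro bdd_aboveI2)
  show "?V z \<gamma> \<le> J k z" if "\<gamma> \<in> \<Gamma>"
    unfolding bellman_less[OF k] using bdd that by (rule cSUP_upper2) simp
  \<comment> \<open>Changing \<open>z\<close> changes \<open>v_next\<close> by the factor
    \<open>1 + net_return\<close>, which is at most \<open>1 + B\<close> in absolute value; this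
    gives the factor \<open>1 + B\<close>.\<close>
  have "(L' * (1 + B))-lipschitz_on UNIV (\<lambda>z. SUP \<gamma>\<in>\<Gamma>. ?V z \<gamma>)"
  proof (rule lipschitz_on_cSUP)
    show "\<Gamma> \<noteq> {}" using zero_mem_modulation_set by auto
    show LB: "0 \<le> L' * (1 + B)" using L' B_nonneg by simp
    show "bdd_above (?V z ` \<Gamma>)" for z by (rule bdd)
    show "(L' * (1 + B))-lipschitz_on UNIV (\<lambda>z. ?V z \<gamma>)" if \<gamma>: "\<gamma> \<in> \<Gamma>" for \<gamma>
    proof (rule lipschitz_onI[OF _ LB])
      fix y z :: real
      have "dist (?V y \<gamma>) (?V z \<gamma>) =
          \<bar>\<integral>\<omega>. ?G (v_next d \<epsilon> y \<gamma> (X k \<omega>)) - ?G (v_next d \<epsilon> z \<gamma> (X k \<omega>)) \<partial>M\<bar>"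
        unfolding stage_value_eq dist_real_def using int[OF \<gamma>] by simp
      also have "\<dots> \<le> (\<integral>\<omega>. \<bar>?G (v_next d \<epsilon> y \<gamma> (X k \<omega>)) - ?G (v_next d \<epsilon> z \<gamma> (X k \<omega>))\<bar> \<partial>M)"
        by (rule integral_abs_bound)
      also have "\<dots> \<le> L' * (1 + B) * dist y z"
      proof (rule integral_le_const)
        show "integrable M (\<lambda>\<omega>. \<bar>?G (v_next d \<epsilon> y \<gamma> (X k \<omega>)) - ?G (v_next d \<epsilon> z \<gamma> (X k \<omega>))\<bar>)"
          using int[OF \<gamma>] by simp
        show "AE \<omega> in M. \<bar>?G (v_next d \<epsilon> y \<gamma> (X k \<omega>)) - ?G (v_next d \<epsilon> z \<gamma> (X k \<omega>))\<bar>
            \<le> L' * (1 + B) * dist y z"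
          using X_in_S[OF k]
        proof eventually_elim
          case (elim \<omega>)
          let ?r = "net_return \<epsilon> \<gamma> (X k \<omega>)"
          have "v_next d \<epsilon> y \<gamma> (X k \<omega>) - v_next d \<epsilon> z \<gamma> (X k \<omega>) = (y - z) * (1 + ?r)"
            by (simp add: v_next_eq algebra_simps)
          then have "\<bar>?G (v_next d \<epsilon> y \<gamma> (X k \<omega>)) - ?G (v_next d \<epsilon> z \<gamma> (X k \<omega>))\<bar>
              \<le> L' * (\<bar>y - z\<bar> * \<bar>1 + ?r\<bar>)"
            using lipschitz_onD[OF G, of "v_next d \<epsilon> y \<gamma> (X k \<omega>)" "v_next d \<epsilon> z \<gamma> (X k \<omega>)"]
            by (simp add: dist_real_def abs_mult)
          also have "\<dots> \<le> L' * (\<bar>y - z\<bar> * (1 + B))"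
            using net_return_le_B[OF \<gamma> elim] L' by (intro mult_left_mono) auto
          finally show ?case by (simp add: dist_real_def mult_ac)
        qed
      qed
      finally show "dist (?V y \<gamma>) (?V z \<gamma>) \<le> L' * (1 + B) * dist y z" .
    qed
  qed
  then show "\<exists>L. L-lipschitz_on UNIV (J k)" unfolding bellman_less[OF k] by blast
qed

end

lemma bellman_lipschitz: "k \<le> N \<Longrightarrow> \<exists>L. L-lipschitz_on UNIV (J k)"
proof (induction k rule: inc_induct)
  case base
  show ?case unfolding bellman_N by (intro exI[of _ 1] lipschitz_onI) auto
next
  case (step n)
  then show ?case using bellman_lipschitz_step by blast
qed

lemma measurable_rescaled_bellman: "k \<le> N \<Longrightarrow> rescaled (J k) \<in> borel_measurable borel"
  using bellman_lipschitz lipschitz_on_rescaled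
  by (meson borel_measurable_continuous_onI lipschitz_on_continuous_on)

lemma integrable_rescaled_bellman:
  "k < N \<Longrightarrow> \<gamma> \<in> \<Gamma> \<Longrightarrow> integrable M (\<lambda>\<omega>. rescaled (J (Suc k)) (v_next d \<epsilon> z \<gamma> (X k \<omega>)))"
  using bellman_lipschitz[of "Suc k"] stage_integrand_integrable by (auto simp: Suc_le_eq)

lemma bellman_ge:
  "k < N \<Longrightarrow> \<gamma> \<in> \<Gamma> \<Longrightarrow> expectation (\<lambda>\<omega>. rescaled (J (Suc k)) (v_next d \<epsilon> z \<gamma> (X k \<omega>))) \<le> J k z"
  using bellman_lipschitz[of "Suc k"] bellman_ge_stage_value unfolding stage_value_eq
  by (auto simp: Suc_le_eq)

text \<open>The common route to lower bounds on \<open>J\<close>: choose one gain and a minorant,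
  linear in the return in the uses below, whose expectation needs only the drift.\<close>

lemma bellman_ge_integral:
  assumes k: "k < N" and \<gamma>: "\<gamma> \<in> \<Gamma>" and int: "integrable M f"
    and le: "\<And>\<omega>. X k \<omega> \<in> S \<Longrightarrow> f \<omega> \<le> rescaled (J (Suc k)) (v_next d \<epsilon> z \<gamma> (X k \<omega>))"
  shows "expectation f \<le> J k z"
proof -
  have "expectation f \<le> expectation (\<lambda>\<omega>. rescaled (J (Suc k)) (v_next d \<epsilon> z \<gamma> (X k \<omega>)))"
    using int integrable_rescaled_bellman[OF k \<gamma>]
    by (rule integral_mono_AE) (use X_in_S[OF k] le in \<open>auto elim: eventually_mono\<close>)
  also have "\<dots> \<le> J k z" by (rule bellman_ge[OF k \<gamma>])
  finally show ?thesis .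
qed

section \<open>Lower bounds on the value functions from LTI gains\<close>

lemma worst_loss_nonneg: "0 \<le> worst_loss S \<epsilon> u"
  using worst_loss_pos[of u] worst_loss_0[OF compact_S S_nonempty, of \<epsilon>] by (cases "u = 0") auto

text \<open>The LTI control \<open>v K\<close> is a drawdown modulated control with \<open>\<gamma> = z / (z - (1 - d)) K\<close>;
  the second hypothesis says that this \<open>\<gamma>\<close> lies in \<open>\<Gamma>\<close>.\<close>

lemma lti_as_modulation:
  assumes "0 \<le> z" "z * worst_loss S \<epsilon> K \<le> z - (1 - d)"
  obtains \<gamma> where "\<gamma> \<in> \<Gamma>" "\<And>x. v_next d \<epsilon> z \<gamma> x = z * (1 + net_return \<epsilon> K x)"
proof (cases "z * worst_loss S \<epsilon> K = 0")
  \<comment> \<open>Here the divisor \<open>z - (1 - d)\<close> may vanish, but the LTI control is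
    0, so the gain 0 reproduces it.\<close>
  case True
  then have "z = 0 \<or> K = 0" using worst_loss_pos[of K] by force
  then have "v_next d \<epsilon> z 0 x = z * (1 + net_return \<epsilon> K x)" for x
    by (auto simp: v_next_eq)
  then show ?thesis using that zero_mem_modulation_set by blast
next
  case False
  then have "0 < z * worst_loss S \<epsilon> K" using assms(1) worst_loss_nonneg[of K] by simp
  with assms(2) have pos: "0 < z - (1 - d)" by simp
  define \<gamma> where "\<gamma> = (z / (z - (1 - d))) *\<^sub>R K"
  show ?thesis
  proof (rule that)
    have s: "0 \<le> z / (z - (1 - d))" using pos assms(1) by simp
    show "\<gamma> \<in> \<Gamma>"
      using assms(2) pos unfolding modulation_set_def \<gamma>_def
      by (simp add: worst_loss_scaleR[OF compact_S S_nonempty s])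
    show "v_next d \<epsilon> z \<gamma> x = z * (1 + net_return \<epsilon> K x)" for x
      unfolding v_next_eq \<gamma>_def net_return_scaleR[OF s] using pos by (simp add: distrib_left)
  qed
qed

text \<open>The last hypothesis is a loss budget for the remaining stages. A worst-case loss leaves
  the state at least \<open>z * (1 - ?q)\<close>, which satisfies the hypothesis with one stage
  fewer; so does the state 1 reached at a new maximum.\<close>

lemma bellman_ge_lti:
  assumes K: "K \<in> \<Gamma>" and "k \<le> N" and "z \<le> 1"
    and "1 - d \<le> z * (1 - worst_loss S \<epsilon> K) ^ (N - k)"
  shows "z * (1 + drift K) ^ (N - k) \<le> J k z"
  using assms(2-4)
proof (induction k arbitrary: z rule: inc_induct)
  case base
  then show ?case by (simp add: bellman_N)
next
  case (step k)
  let ?q = "worst_loss S \<epsilon> K"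
  define n where "n = N - Suc k"
  have n: "N - k = Suc n" using step.hyps by (simp add: n_def)
  have q: "0 \<le> ?q" "?q \<le> 1" using worst_loss_nonneg K by (auto simp: modulation_set_def)
  have k: "k < N" by fact
  have p: "1 - d \<le> z * (1 - ?q) * (1 - ?q) ^ n" using step.prems by (simp add: n mult_ac)
  have pn: "0 \<le> (1 - ?q) ^ n" "(1 - ?q) ^ n \<le> 1" using q by (auto intro: power_le_one)
  \<comment> \<open>The budget bounds a product below by \<open>1 - d\<close>, which is positive
    because \<open>d < 1\<close>; a nonpositive first factor would contradict this.\<close>
  have zq: "0 < z * (1 - ?q)"
  proof (rule ccontr)
    assume "\<not> ?thesis"
    then have "z * (1 - ?q) * (1 - ?q) ^ n \<le> 0" using pn by (simp add: mult_nonpos_nonneg)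
    with p d_less_1 show False by simp
  qed
  then have z: "0 < z" using q by (simp add: zero_less_mult_iff)
  \<comment> \<open>Dropping the factor for the later stages leaves the condition under which the
    LTI gain is an admissible modulation.\<close>
  have "z * (1 - ?q) * (1 - ?q) ^ n \<le> z * (1 - ?q)" using pn zq by (simp add: mult_left_le)
  with p have "z * ?q \<le> z - (1 - d)" by (simp add: algebra_simps)
  then obtain \<gamma> where \<gamma>: "\<gamma> \<in> \<Gamma>" "\<And>x. v_next d \<epsilon> z \<gamma> x = z * (1 + net_return \<epsilon> K x)"
    using lti_as_modulation[of z K] z by auto
  let ?C = "(1 + drift K) ^ n"
  have "expectation (\<lambda>\<omega>. v_next d \<epsilon> z \<gamma> (X k \<omega>) * ?C) \<le> J k z"
  proof (rule bellman_ge_integral[OF k \<gamma>(1)])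
    show "integrable M (\<lambda>\<omega>. v_next d \<epsilon> z \<gamma> (X k \<omega>) * ?C)"
      using expectation_v_next(1)[OF k] by simp
    fix \<omega> assume "X k \<omega> \<in> S"
    then have v: "z * (1 - ?q) \<le> v_next d \<epsilon> z \<gamma> (X k \<omega>)"
      using net_return_ge[OF compact_S, of "X k \<omega>" \<epsilon> K] z unfolding \<gamma>(2)
      by (intro mult_left_mono) auto
    show "v_next d \<epsilon> z \<gamma> (X k \<omega>) * ?C \<le> rescaled (J (Suc k)) (v_next d \<epsilon> z \<gamma> (X k \<omega>))"
    proof (cases "v_next d \<epsilon> z \<gamma> (X k \<omega>) \<le> 1")
      case True
      have "1 - d \<le> v_next d \<epsilon> z \<gamma> (X k \<omega>) * (1 - ?q) ^ n"
        using p mult_right_mono[OF v pn(1)] by linarith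
      then show ?thesis using step.IH[OF True] True by (simp add: rescaled_le_1 n_def)
    next
      case False
      \<comment> \<open>The state is reset to 1; since \<open>z * (1 - ?q)\<close> is at most 1, the
        budget passes to 1.\<close>
      have "z * (1 - ?q) \<le> 1" using z step.prems(1) q by (intro mult_le_one) auto
      then have "1 - d \<le> 1 * (1 - ?q) ^ n"
        using p mult_right_mono[OF _ pn(1), of "z * (1 - ?q)" 1] by linarith
      then have "?C \<le> J (Suc k) 1" using step.IH[of 1] by (simp add: n_def)
      then show ?thesis using False by (simp add: rescaled_ge_1)
    qed
  qed
  moreover have "expectation (\<lambda>\<omega>. v_next d \<epsilon> z \<gamma> (X k \<omega>)) = z * (1 + drift K)"
    unfolding \<gamma>(2) using integrable_net_return[OF k] expectation_net_return[OF k]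
    by (simp add: prob_space)
  ultimately show ?case by (simp add: n mult_ac)
qed

text \<open>At the last stage the gain \<open>K\<close> can be scaled up to exhaust the loss budget \<open>d\<close>, which exceeds
  \<open>worst_loss S \<epsilon> K\<close>. Going back from there, the running maximum is reached again whenever the
  LTI return is nonnegative, and on that event the surplus of the next stage is collected.\<close>

lemma bellman_1_greater_lti:
  assumes K: "K \<in> \<Gamma>" and drift: "0 < drift K" and N: "2 \<le> N"
    and q_N: "1 - d \<le> (1 - worst_loss S \<epsilon> K) ^ N" and "k \<le> N - 1"
  shows "(1 + drift K) ^ (N - k) < J k 1"
proof -
  let ?q = "worst_loss S \<epsilon> K"
  have "K \<noteq> 0" using drift by auto
  then have q: "0 < ?q" "?q \<le> 1" using worst_loss_pos K by (auto simp: modulation_set_def)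
  \<comment> \<open>For \<open>?q = 1\<close> the budget would read
    \<open>1 - d \<le> 0\<close>.\<close>
  have "?q < 1"
  proof (rule ccontr)
    assume "\<not> ?q < 1"
    with q have "?q = 1" by simp
    then show False using q_N N d_less_1 by (simp add: power_0_left)
  qed
  \<comment> \<open>With at least two stages the budget covers more than a single worst loss; hence
    the slack \<open>?q < d\<close> at the last stage.\<close>
  have "(1 - ?q) ^ N \<le> (1 - ?q) ^ 2" using q N by (intro power_decreasing) auto
  also have "\<dots> < 1 - ?q" using q \<open>?q < 1\<close> by (simp add: power2_eq_square)
  finally have qd: "?q < d" using q_N by simp
  show ?thesis
    using \<open>k \<le> N - 1\<close>
  proof (induction k rule: inc_induct)
    case base
    \<comment> \<open>Scaling by \<open>1 / ?q\<close> brings the worst loss to exactly 1. From the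
      state 1 the effective drift becomes \<open>d / ?q\<close> times that of
      \<open>K\<close>.\<close>
    define \<gamma> where "\<gamma> = (1 / ?q) *\<^sub>R K"
    have k: "N - 1 < N" "Suc (N - 1) = N" "N - (N - 1) = 1" using N by auto
    have \<gamma>: "\<gamma> \<in> \<Gamma>"
      using q by (simp add: modulation_set_def \<gamma>_def worst_loss_scaleR[OF compact_S S_nonempty])
    have "?q * drift K < d * drift K" using qd drift by simp
    then have "1 + drift K < 1 + (1 - (1 - d)) * drift \<gamma>"
      using q by (simp add: \<gamma>_def net_return_scaleR field_simps)
    also have "\<dots> = expectation (\<lambda>\<omega>. v_next d \<epsilon> 1 \<gamma> (X (N - 1) \<omega>))"
      using expectation_v_next(2)[OF k(1)] by simp
    also have "\<dots> \<le> J (N - 1) 1"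
      by (rule bellman_ge_integral[OF k(1) \<gamma> expectation_v_next(1)[OF k(1)]])
        (simp only: k(2) bellman_N, simp add: rescaled_def)
    finally show ?case by (simp only: k(3) power_one_right)
  next
    case (step k)
    define n where "n = N - Suc k"
    have k: "k < N" "N - k = Suc n" using step.hyps by (auto simp: n_def)
    let ?C = "(1 + drift K) ^ n" and ?r = "\<lambda>\<omega>. net_return \<epsilon> K (X k \<omega>)"
    define \<delta> where "\<delta> = J (Suc k) 1 - ?C"
    have \<delta>: "0 < \<delta>" using step.IH by (simp add: \<delta>_def n_def)
    obtain \<gamma> where \<gamma>: "\<gamma> \<in> \<Gamma>" "\<And>x. v_next d \<epsilon> 1 \<gamma> x = 1 * (1 + net_return \<epsilon> K x)"
      using lti_as_modulation[of 1 K] qd by auto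
    \<comment> \<open>The extra term \<open>\<delta> * ?r\<close> is below the collected surplus
      \<open>\<delta> * (1 + ?r)\<close> when \<open>?r\<close> is nonnegative and is nonpositive
      otherwise. Being linear, it has expectation \<open>\<delta> * drift K\<close>, so no
      probability of a gain has to be estimated.\<close>
    have "expectation (\<lambda>\<omega>. (1 + ?r \<omega>) * ?C + \<delta> * ?r \<omega>) \<le> J k 1"
    proof (rule bellman_ge_integral[OF k(1) \<gamma>(1)])
      show "integrable M (\<lambda>\<omega>. (1 + ?r \<omega>) * ?C + \<delta> * ?r \<omega>)"
        using integrable_net_return[OF k(1)] by simp
      fix \<omega> assume "X k \<omega> \<in> S"
      then have r: "- ?q \<le> ?r \<omega>" by (rule net_return_ge[OF compact_S])
      have "(1 + ?r \<omega>) * ?C + \<delta> * ?r \<omega> \<le> rescaled (J (Suc k)) (1 + ?r \<omega>)"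
      proof (cases "0 \<le> ?r \<omega>")
        case True
        then have "rescaled (J (Suc k)) (1 + ?r \<omega>) = (1 + ?r \<omega>) * (?C + \<delta>)"
          by (simp add: rescaled_ge_1 \<delta>_def)
        then show ?thesis using \<delta> by (simp add: algebra_simps)
      next
        case False
        have "1 - d \<le> (1 - ?q) * (1 - ?q) ^ n"
        proof -
          have "(1 - ?q) ^ N \<le> (1 - ?q) ^ Suc n" using q k by (intro power_decreasing) auto
          then show ?thesis using q_N by simp
        qed
        also have "\<dots> \<le> (1 + ?r \<omega>) * (1 - ?q) ^ n"
          using r q by (intro mult_right_mono) auto
        finally have "(1 + ?r \<omega>) * ?C \<le> J (Suc k) (1 + ?r \<omega>)"
          using bellman_ge_lti[OF K, of "Suc k" "1 + ?r \<omega>"] k False by (simp add: n_def)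
        moreover have "\<delta> * ?r \<omega> \<le> 0" using \<delta> False by (simp add: mult_nonneg_nonpos)
        ultimately show ?thesis using False by (simp add: rescaled_le_1)
      qed
      then show "(1 + ?r \<omega>) * ?C + \<delta> * ?r \<omega> \<le> rescaled (J (Suc k)) (v_next d \<epsilon> 1 \<gamma> (X k \<omega>))"
        by (simp add: \<gamma>(2))
    qed
    moreover have "expectation (\<lambda>\<omega>. (1 + ?r \<omega>) * ?C + \<delta> * ?r \<omega>) = (1 + drift K) * ?C + \<delta> * drift K"
      using integrable_net_return[OF k(1)] expectation_net_return[OF k(1)] by (simp add: prob_space)
    ultimately have "(1 + drift K) * ?C + \<delta> * drift K \<le> J k 1" by simp
    moreover have "0 < \<delta> * drift K" using \<delta> drift by simp
    ultimately show ?case by (simp add: k(2))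
  qed
qed

section \<open>Expected account value under the LTI policy\<close>

lemma AE_X_in_S: "k \<le> N \<Longrightarrow> AE \<omega> in M. \<forall>j<k. X j \<omega> \<in> S"
  using X_in_S by (auto simp: AE_all_countable)

text \<open>An admissible gain never loses more than the whole account. Nonnegativity lets the
  account value be factored out of the absolute value in the cost; the upper bound gives
  integrability.\<close>

lemma account_lti_bounds:
  assumes K: "K \<in> \<Gamma>" and "0 < V\<^sub>0" and "\<forall>j<k. x j \<in> S"
  shows "0 \<le> account (lti_policy K) \<epsilon> V\<^sub>0 x k \<and> account (lti_policy K) \<epsilon> V\<^sub>0 x k \<le> V\<^sub>0 * (1 + B) ^ k"
  using assms(3)
proof (induction k)
  case 0
  then show ?case using assms(2) by simp
next
  case (Suc k)
  let ?v = "account (lti_policy K) \<epsilon> V\<^sub>0 x k" and ?r = "net_return \<epsilon> K (x k)"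
  have v: "0 \<le> ?v" "?v \<le> V\<^sub>0 * (1 + B) ^ k" using Suc by auto
  have eq: "account (lti_policy K) \<epsilon> V\<^sub>0 x (Suc k) = ?v * (1 + ?r)"
    using v by (simp add: account_Suc lti_policy_def net_return_scaleR algebra_simps)
  have "x k \<in> S" using Suc.prems by simp
  then have r: "-1 \<le> ?r" "\<bar>?r\<bar> \<le> B"
    by (simp_all add: K net_return_ge_minus_1 net_return_le_B)
  have "?v * (1 + ?r) \<le> V\<^sub>0 * (1 + B) ^ k * (1 + B)"
    using v r by (intro mult_mono) auto
  then show ?case using v r unfolding eq by (simp add: mult_ac)
qed

lemma expectation_account_lti:
  assumes K: "K \<in> \<Gamma>" and V\<^sub>0: "0 < V\<^sub>0" and "k \<le> N"
  shows "integrable M (\<lambda>\<omega>. account (lti_policy K) \<epsilon> V\<^sub>0 (\<lambda>k. X k \<omega>) k) \<and>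
    expectation (\<lambda>\<omega>. account (lti_policy K) \<epsilon> V\<^sub>0 (\<lambda>k. X k \<omega>) k) = V\<^sub>0 * (1 + drift K) ^ k"
  using \<open>k \<le> N\<close>
proof (induction k)
  case 0
  then show ?case by (simp add: prob_space)
next
  case (Suc k)
  let ?V = "\<lambda>k \<omega>. account (lti_policy K) \<epsilon> V\<^sub>0 (\<lambda>k. X k \<omega>) k"
  have k: "k < N" using Suc.prems by simp
  have meas: "?V j \<in> borel_measurable (past M X j)" for j
    by (rule measurable_account[THEN conjunct1, of j]) (simp_all add: lti_policy_def)
  have sub: "subalgebra M (past M X j)" if "j \<le> N" for j
    using that by (intro subalgebra_past measurable_X) simp
  have int: "integrable M (?V j)" if "j \<le> N" for j
  proof (rule integrable_const_bound)
    show "AE \<omega> in M. norm (?V j \<omega>) \<le> V\<^sub>0 * (1 + B) ^ j"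
      using AE_X_in_S[OF that] by eventually_elim (simp add: account_lti_bounds K V\<^sub>0)
    show "?V j \<in> borel_measurable M" by (rule measurable_from_subalg[OF sub[OF that] meas])
  qed
  let ?f = "\<lambda>(v, x). v * (1 + net_return \<epsilon> K x)"
  \<comment> \<open>The product form needs a nonnegative account, which holds on the almost sure
    event that the past returns lie in \<open>S\<close>.\<close>
  have eq: "AE \<omega> in M. ?V (Suc k) \<omega> = ?f (?V k \<omega>, X k \<omega>)"
    using AE_X_in_S[OF less_imp_le[OF k]]
  proof eventually_elim
    case (elim \<omega>)
    then have "0 \<le> ?V k \<omega>" using account_lti_bounds[OF K V\<^sub>0 elim] by simp
    then show ?case by (simp add: account_Suc lti_policy_def net_return_scaleR algebra_simps)
  qed
  have f: "?f \<in> borel_measurable (borel \<Otimes>\<^sub>M borel)" by measurable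
  have [measurable]: "X k \<in> borel_measurable M" "?V k \<in> borel_measurable M" "?V (Suc k) \<in> borel_measurable M"
    using measurable_X[OF k] int[of k] int[of "Suc k"] k by auto
  have "integrable M (\<lambda>\<omega>. ?f (?V k \<omega>, X k \<omega>)) \<longleftrightarrow> integrable M (?V (Suc k))"
    using eq by (intro integrable_cong_AE) auto
  then have intf: "integrable M (\<lambda>\<omega>. ?f (?V k \<omega>, X k \<omega>))" using int[of "Suc k"] Suc.prems by simp
  have "expectation (?V (Suc k)) = expectation (\<lambda>\<omega>. ?f (?V k \<omega>, X k \<omega>))"
    using eq by (intro integral_cong_AE) auto
  also have "\<dots> = expectation (\<lambda>\<omega>'. expectation (\<lambda>\<omega>. ?f (?V k \<omega>', X k \<omega>)))"
    by (rule expectation_past_X[OF k meas f intf])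
  also have "\<dots> = expectation (\<lambda>\<omega>. ?V k \<omega> * (1 + drift K))"
    using integrable_net_return[OF k] expectation_net_return[OF k] by (simp add: prob_space)
  also have "\<dots> = V\<^sub>0 * (1 + drift K) ^ Suc k"
    using Suc k by simp
  finally show ?case using int[of "Suc k"] Suc.prems by simp
qed

section \<open>Expected account value under an optimal modulation\<close>

lemma modulated_control:
  "modulated_policy d \<gamma> k v v_max =
    (v_max * (v / v_max - (1 - d))) *\<^sub>R (if v / v_max \<in> {1 - d..1} then \<gamma> k (v / v_max) else 0)"
  by (simp add: modulated_policy_def Let_def)

text \<open>Extension by 0 outside the interval makes the gain Borel on the whole line and matches
  the control 0 chosen there by \<open>modulated_policy\<close>.\<close>

lemma measurable_modulation:
  assumes "optimal_modulation M S d \<epsilon> X N \<gamma>" "k < N"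
  shows "(\<lambda>z. if z \<in> {1 - d..1} then \<gamma> k z else 0) \<in> borel_measurable borel"
proof -
  have "\<gamma> k \<in> borel_measurable (restrict_space borel {1 - d..1})"
    using assms by (simp add: optimal_modulation_def)
  then show ?thesis
    by (subst (asm) measurable_restrict_space_iff[where c = 0]) simp_all
qed

text \<open>The nonnegative cushion and the positive running maximum factor out of the cost and of
  the new maximum, leaving the normalized dynamics of the Bellman recursion.\<close>

lemma account_modulated_Suc:
  fixes \<gamma> V\<^sub>0 x k
  defines "V \<equiv> account (modulated_policy d \<gamma>) \<epsilon> V\<^sub>0 x"
    and "W \<equiv> running_max (modulated_policy d \<gamma>) \<epsilon> V\<^sub>0 x"
  defines "z \<equiv> V k / W k"
  assumes W: "0 < W k" and z: "z \<in> {1 - d..1}"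
  shows "V (Suc k) = W k * v_next d \<epsilon> z (\<gamma> k z) (x k)"
    and "W (Suc k) = W k * w_next d \<epsilon> z (\<gamma> k z) (x k)"
    and "V (Suc k) / W (Suc k) = z_next d \<epsilon> z (\<gamma> k z) (x k)"
proof -
  have V: "V k = W k * z" using W by (simp add: z_def)
  have s: "0 \<le> W k * (z - (1 - d))" using W z by simp
  have u: "modulated_policy d \<gamma> k (V k) (W k) = (W k * (z - (1 - d))) *\<^sub>R \<gamma> k z"
    using z by (simp add: modulated_control z_def)
  have "V (Suc k) = V k + net_return \<epsilon> (modulated_policy d \<gamma> k (V k) (W k)) (x k)"
    unfolding V_def W_def by (rule account_Suc)
  then show Vs: "V (Suc k) = W k * v_next d \<epsilon> z (\<gamma> k z) (x k)"
    unfolding v_next_eq u net_return_scaleR[OF s] by (simp add: V algebra_simps)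
  have "W (Suc k) = max (W k) (V (Suc k))"
    unfolding V_def W_def by (rule running_max_Suc)
  then show Ws: "W (Suc k) = W k * w_next d \<epsilon> z (\<gamma> k z) (x k)"
    unfolding w_next_def Vs using W by (simp add: max_mult_distrib_left)
  show "V (Suc k) / W (Suc k) = z_next d \<epsilon> z (\<gamma> k z) (x k)"
    unfolding Vs Ws z_next_def using W by simp
qed

text \<open>A net return of at least -1 can consume at most the cushion \<open>z - (1 - d)\<close>,
  so the drawdown limit is kept. The cushion is at most 1, hence the growth factor
  \<open>1 + B\<close>.\<close>

lemma account_modulated_bounds:
  assumes opt: "optimal_modulation M S d \<epsilon> X N \<gamma>" and V\<^sub>0: "0 < V\<^sub>0"
    and "k \<le> N" and "\<forall>j<k. x j \<in> S"
  shows "0 < running_max (modulated_policy d \<gamma>) \<epsilon> V\<^sub>0 x k \<and>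
    running_max (modulated_policy d \<gamma>) \<epsilon> V\<^sub>0 x k \<le> V\<^sub>0 * (1 + B) ^ k \<and>
    account (modulated_policy d \<gamma>) \<epsilon> V\<^sub>0 x k / running_max (modulated_policy d \<gamma>) \<epsilon> V\<^sub>0 x k
      \<in> {1 - d..1}"
  using assms(3,4)
proof (induction k)
  case 0
  then show ?case using V\<^sub>0 d_nonneg by (simp add: running_max_0)
next
  case (Suc k)
  let ?V = "account (modulated_policy d \<gamma>) \<epsilon> V\<^sub>0 x" and ?W = "running_max (modulated_policy d \<gamma>) \<epsilon> V\<^sub>0 x"
  define z where "z = ?V k / ?W k"
  have W: "0 < ?W k" "?W k \<le> V\<^sub>0 * (1 + B) ^ k" and z': "?V k / ?W k \<in> {1 - d..1}"
    using Suc by auto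
  then have z: "z \<in> {1 - d..1}" by (simp add: z_def)
  have \<gamma>: "\<gamma> k z \<in> \<Gamma>" using opt Suc.prems z by (simp add: optimal_modulation_def)
  have x: "x k \<in> S" using Suc.prems by simp
  note step = account_modulated_Suc[OF W(1) z', folded z_def]
  let ?r = "net_return \<epsilon> (\<gamma> k z) (x k)" and ?v = "v_next d \<epsilon> z (\<gamma> k z) (x k)"
    and ?w = "w_next d \<epsilon> z (\<gamma> k z) (x k)"
  have "(z - (1 - d)) * -1 \<le> (z - (1 - d)) * ?r"
    using net_return_ge_minus_1[OF \<gamma> x] z by (intro mult_left_mono) auto
  then have v_ge: "1 - d \<le> ?v" by (simp add: v_next_eq)
  have "(z - (1 - d)) * ?r \<le> 1 * B"
    using net_return_le_B[OF \<gamma> x] z d_less_1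
    by (intro order_trans[OF mult_left_mono mult_right_mono, of _ B]) (auto simp: B_nonneg)
  then have w: "1 \<le> ?w" "?w \<le> 1 + B" using z B_nonneg by (auto simp: w_next_def v_next_eq)
  have "?W k * ?w \<le> V\<^sub>0 * (1 + B) ^ k * (1 + B)"
    using W w B_nonneg by (intro mult_mono) auto
  moreover have "z_next d \<epsilon> z (\<gamma> k z) (x k) \<in> {1 - d..1}"
    using v_ge d_nonneg by (auto simp: z_next_def w_next_def max_def)
  ultimately show ?case using W w unfolding step(2) step(3)[unfolded step(2)] by (simp add: mult_ac)
qed

text \<open>Given the past, \<open>W k\<close> is a known scale and the expected next value is the
  stage value at the chosen gain. Attainment of the supremum turns it into
  \<open>J k\<close>.\<close>

lemma expectation_modulated_step:
  assumes opt: "optimal_modulation M S d \<epsilon> X N \<gamma>" and V\<^sub>0: "0 < V\<^sub>0" and k: "k < N"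
  defines "V \<equiv> \<lambda>k \<omega>. account (modulated_policy d \<gamma>) \<epsilon> V\<^sub>0 (\<lambda>k. X k \<omega>) k"
    and "W \<equiv> \<lambda>k \<omega>. running_max (modulated_policy d \<gamma>) \<epsilon> V\<^sub>0 (\<lambda>k. X k \<omega>) k"
  shows "integrable M (\<lambda>\<omega>. W (Suc k) \<omega> * J (Suc k) (V (Suc k) \<omega> / W (Suc k) \<omega>))"
    and "expectation (\<lambda>\<omega>. W (Suc k) \<omega> * J (Suc k) (V (Suc k) \<omega> / W (Suc k) \<omega>)) =
    expectation (\<lambda>\<omega>. W k \<omega> * J k (V k \<omega> / W k \<omega>))"
proof -
  define g where "g k z = (if z \<in> {1 - d..1} then \<gamma> k z else 0)" for k z
  have g [measurable]: "g j \<in> borel_measurable borel" if "j < N" for j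
    unfolding g_def[abs_def] by (rule measurable_modulation[OF opt that])
  have pol: "(\<lambda>(v, v_max). modulated_policy d \<gamma> j v v_max) \<in> borel_measurable (borel \<Otimes>\<^sub>M borel)"
    if "j < N" for j
    unfolding modulated_control g_def[symmetric] using g[OF that] by measurable
  have meas: "V j \<in> borel_measurable (past M X j)" "W j \<in> borel_measurable (past M X j)" if "j \<le> N" for j
    unfolding V_def W_def
    by (rule measurable_account[THEN conjunct1, of N] measurable_account[THEN conjunct2, of N],
        use pol that in auto)+
  have sub: "subalgebra M (past M X j)" if "j \<le> N" for j
    using that by (intro subalgebra_past measurable_X) simp
  have measM: "V j \<in> borel_measurable M" "W j \<in> borel_measurable M" if "j \<le> N" for j
    using meas[OF that] measurable_from_subalg[OF sub[OF that]] by blast+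
  have bellman [measurable]: "J j \<in> borel_measurable borel" if "j \<le> N" for j
    using bellman_lipschitz[OF that]
    by (auto intro: borel_measurable_continuous_onI lipschitz_on_continuous_on)
  have state: "AE \<omega> in M. 0 < W j \<omega> \<and> W j \<omega> \<le> V\<^sub>0 * (1 + B) ^ j \<and> V j \<omega> / W j \<omega> \<in> {1 - d..1}"
    if "j \<le> N" for j
    using AE_X_in_S[OF that]
  proof eventually_elim
    case (elim \<omega>)
    show ?case unfolding V_def W_def by (rule account_modulated_bounds[OF opt V\<^sub>0 that elim])
  qed
  have kN: "k \<le> N" "Suc k \<le> N" using k by auto
  have mM [measurable]: "V k \<in> borel_measurable M" "W k \<in> borel_measurable M"
    "V (Suc k) \<in> borel_measurable M" "W (Suc k) \<in> borel_measurable M"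
    using measM kN by auto
  note [measurable] = bellman[OF kN(1)] bellman[OF kN(2)] g[OF k] measurable_X[OF k]
    measurable_rescaled_bellman[OF kN(2)]
  show int: "integrable M (\<lambda>\<omega>. W (Suc k) \<omega> * J (Suc k) (V (Suc k) \<omega> / W (Suc k) \<omega>))"
  proof -
    \<comment> \<open>States in \<open>{1 - d..1}\<close> have distance at most 1 from 1, so the
      Lipschitz bound gives \<open>?c\<close> as a uniform bound on \<open>J\<close>.\<close>
    obtain L where L: "L-lipschitz_on UNIV (J (Suc k))" using bellman_lipschitz[OF kN(2)] by blast
    let ?c = "\<bar>J (Suc k) 1\<bar> + L"
    show ?thesis
    proof (rule integrable_const_bound)
      show "AE \<omega> in M. norm (W (Suc k) \<omega> * J (Suc k) (V (Suc k) \<omega> / W (Suc k) \<omega>))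
          \<le> V\<^sub>0 * (1 + B) ^ Suc k * ?c"
        using state[OF kN(2)]
      proof eventually_elim
        case (elim \<omega>)
        let ?z = "V (Suc k) \<omega> / W (Suc k) \<omega>"
        have "\<bar>J (Suc k) ?z - J (Suc k) 1\<bar> \<le> L * \<bar>?z - 1\<bar>"
          using lipschitz_onD[OF L, of ?z 1] by (simp add: dist_real_def)
        also have "\<dots> \<le> L * 1"
          using elim d_less_1 lipschitz_on_nonneg[OF L] by (intro mult_left_mono) auto
        finally have "\<bar>J (Suc k) ?z\<bar> \<le> ?c" by linarith
        then have "\<bar>W (Suc k) \<omega>\<bar> * \<bar>J (Suc k) ?z\<bar> \<le> V\<^sub>0 * (1 + B) ^ Suc k * ?c"
          using elim by (intro mult_mono) auto
        then show ?case by (simp add: abs_mult)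
      qed
    qed measurable
  qed
  let ?f = "\<lambda>(y, x). snd y * rescaled (J (Suc k)) (v_next d \<epsilon> (fst y / snd y) (g k (fst y / snd y)) x)"
  have f: "?f \<in> borel_measurable ((borel \<Otimes>\<^sub>M borel) \<Otimes>\<^sub>M borel)"
    unfolding v_next_eq by measurable
  have eq: "AE \<omega> in M. W (Suc k) \<omega> * J (Suc k) (V (Suc k) \<omega> / W (Suc k) \<omega>) =
      ?f ((V k \<omega>, W k \<omega>), X k \<omega>)"
    using state[OF kN(1)]
  proof eventually_elim
    case (elim \<omega>)
    let ?z = "V k \<omega> / W k \<omega>"
    have "W (Suc k) \<omega> = W k \<omega> * w_next d \<epsilon> ?z (\<gamma> k ?z) (X k \<omega>)"
      and "V (Suc k) \<omega> / W (Suc k) \<omega> = z_next d \<epsilon> ?z (\<gamma> k ?z) (X k \<omega>)"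
      using account_modulated_Suc(2,3)[of \<gamma> V\<^sub>0 "\<lambda>k. X k \<omega>" k] elim
      unfolding V_def W_def by blast+
    moreover have "g k ?z = \<gamma> k ?z" using elim by (simp add: g_def)
    ultimately show ?case by (simp add: w_next_z_next[symmetric] mult.assoc)
  qed
  have "integrable M (\<lambda>\<omega>. ?f ((V k \<omega>, W k \<omega>), X k \<omega>)) \<longleftrightarrow>
      integrable M (\<lambda>\<omega>. W (Suc k) \<omega> * J (Suc k) (V (Suc k) \<omega> / W (Suc k) \<omega>))"
    using eq unfolding v_next_eq by (intro integrable_cong_AE) auto
  with int have intf: "integrable M (\<lambda>\<omega>. ?f ((V k \<omega>, W k \<omega>), X k \<omega>))" by blast
  have "expectation (\<lambda>\<omega>. W (Suc k) \<omega> * J (Suc k) (V (Suc k) \<omega> / W (Suc k) \<omega>)) =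
      expectation (\<lambda>\<omega>. ?f ((V k \<omega>, W k \<omega>), X k \<omega>))"
    using eq unfolding v_next_eq by (intro integral_cong_AE) auto
  also have "\<dots> = expectation (\<lambda>\<omega>'. expectation (\<lambda>\<omega>. ?f ((V k \<omega>', W k \<omega>'), X k \<omega>)))"
    by (rule expectation_past_X[OF k _ f intf]) (intro measurable_Pair meas kN)
  also have "\<dots> = expectation (\<lambda>\<omega>. W k \<omega> * J k (V k \<omega> / W k \<omega>))"
  proof (rule integral_cong_AE)
    show "AE \<omega>' in M. expectation (\<lambda>\<omega>. ?f ((V k \<omega>', W k \<omega>'), X k \<omega>)) = W k \<omega>' * J k (V k \<omega>' / W k \<omega>')"
      using state[OF kN(1)]
    proof eventually_elim
      case (elim \<omega>')
      let ?z = "V k \<omega>' / W k \<omega>'"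
      have "expectation (\<lambda>\<omega>. rescaled (J (Suc k)) (v_next d \<epsilon> ?z (\<gamma> k ?z) (X k \<omega>))) = J k ?z"
        using opt k elim unfolding optimal_modulation_def stage_value_eq by blast
      then show ?case using elim by (simp add: g_def)
    qed
    show "(\<lambda>\<omega>'. expectation (\<lambda>\<omega>. ?f ((V k \<omega>', W k \<omega>'), X k \<omega>))) \<in> borel_measurable M"
      unfolding v_next_eq by measurable
  qed measurable
  finally show "expectation (\<lambda>\<omega>. W (Suc k) \<omega> * J (Suc k) (V (Suc k) \<omega> / W (Suc k) \<omega>)) =
    expectation (\<lambda>\<omega>. W k \<omega> * J k (V k \<omega> / W k \<omega>))" .
qed

lemma expectation_account_modulated:
  assumes opt: "optimal_modulation M S d \<epsilon> X N \<gamma>" and V\<^sub>0: "0 < V\<^sub>0"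
  shows "integrable M (\<lambda>\<omega>. account (modulated_policy d \<gamma>) \<epsilon> V\<^sub>0 (\<lambda>k. X k \<omega>) N)"
    and "expectation (\<lambda>\<omega>. account (modulated_policy d \<gamma>) \<epsilon> V\<^sub>0 (\<lambda>k. X k \<omega>) N) = V\<^sub>0 * J 0 1"
proof -
  let ?V = "\<lambda>k \<omega>. account (modulated_policy d \<gamma>) \<epsilon> V\<^sub>0 (\<lambda>k. X k \<omega>) k"
  let ?W = "\<lambda>k \<omega>. running_max (modulated_policy d \<gamma>) \<epsilon> V\<^sub>0 (\<lambda>k. X k \<omega>) k"
  have "integrable M (\<lambda>\<omega>. ?W k \<omega> * J k (?V k \<omega> / ?W k \<omega>)) \<and>
      expectation (\<lambda>\<omega>. ?W k \<omega> * J k (?V k \<omega> / ?W k \<omega>)) = V\<^sub>0 * J 0 1" if "k \<le> N" for k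
    using that
  proof (induction k)
    case 0
    then show ?case using V\<^sub>0 by (simp add: running_max_0 prob_space)
  next
    case (Suc k)
    then show ?case using expectation_modulated_step[OF opt V\<^sub>0, of k] by simp
  qed
  note N = this[OF order_refl]
  \<comment> \<open>The terminal value function is the identity, so the maximum cancels. This holds
    on every path because the running maximum never drops below \<open>V\<^sub>0\<close>.\<close>
  have "?W N \<omega> * J N (?V N \<omega> / ?W N \<omega>) = ?V N \<omega>" for \<omega>
  proof -
    have "V\<^sub>0 \<le> running_max (modulated_policy d \<gamma>) \<epsilon> V\<^sub>0 x k" for x k
      by (induction k) (auto simp: running_max_0 running_max_Suc)
    then have "0 < ?W N \<omega>" using V\<^sub>0 by (rule less_le_trans[rotated])
    then show ?thesis by (simp add: bellman_N)
  qed
  with N show "integrable M (?V N)" and "expectation (?V N) = V\<^sub>0 * J 0 1" by simp_all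
qed

end

section \<open>Comparison of the expected returns\<close>

theorem theorem5p3:
  fixes M :: "'a measure"
    and X :: "nat \<Rightarrow> 'a \<Rightarrow> real ^ 'm"
    and S :: "(real ^ 'm) set"
    and \<epsilon> \<mu> K :: "real ^ 'm"
    and N :: nat
    and V\<^sub>0 d :: real
    and \<gamma> :: "nat \<Rightarrow> real \<Rightarrow> real ^ 'm"
  assumes "prob_space M"
    and "V\<^sub>0 > 0"
    and "\<And>i. \<epsilon> $ i \<ge> 0"
    and "compact S" and "S \<noteq> {}"
    and "N \<ge> 2"
    and "\<And>k. k < N \<Longrightarrow> X k \<in> borel_measurable M"
    and "\<And>k. k < N \<Longrightarrow> AE \<omega> in M. X k \<omega> \<in> S"
    and "\<And>k. k < N \<Longrightarrow> AE \<omega> in M. \<forall>i. real_cond_exp M (past M X k) (\<lambda>\<omega>. X k \<omega> $ i) \<omega> = \<mu> $ i"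
    and "\<And>k. k < N \<Longrightarrow>
      prob_space.indep_set M {X k -` A \<inter> space M | A. A \<in> sets borel} (sets (past M X k))"
    and "\<And>u. u \<noteq> 0 \<Longrightarrow> worst_loss S \<epsilon> u > 0"
    and "0 \<le> d" and "d < 1"
    and "K \<in> admissible_gains S \<epsilon>"
    and "worst_loss S \<epsilon> K \<le> 1 - (1 - d) powr (1 / real N)"
    and "optimal_modulation M S d \<epsilon> X N \<gamma>"
  shows "prob_space.expectation M (account_return (modulated_policy d \<gamma>) \<epsilon> V\<^sub>0 N X)
           = bellman M S d \<epsilon> X N 0 1 - 1
       \<and> bellman M S d \<epsilon> X N 0 1 - 1
           \<ge> prob_space.expectation M (account_return (lti_policy K) \<epsilon> V\<^sub>0 N X)
       \<and> (K \<bullet> \<mu> - \<epsilon> \<bullet> \<bar>K\<bar> > 0 \<longrightarrow>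
            bellman M S d \<epsilon> X N 0 1 - 1
              > prob_space.expectation M (account_return (lti_policy K) \<epsilon> V\<^sub>0 N X))"
proof -
  interpret return_model M X S \<epsilon> \<mu> N d
    by (intro return_model.intro return_model_axioms.intro) (fact assms)+
  have K: "K \<in> \<Gamma>"
    using assms(14) by (simp add: modulation_set_def admissible_gains_def worst_loss_def)
  have q: "(1 - d) powr (1 / real N) \<le> 1 - worst_loss S \<epsilon> K" using assms(15) by simp
  \<comment> \<open>Taking \<open>N\<close>-th powers turns the bound on the worst loss of
    \<open>K\<close> into the loss budget at stage 0 and state 1.\<close>
  have "1 - d = ((1 - d) powr (1 / real N)) ^ N"
    using assms(6) d_less_1 by (simp add: powr_power)
  also have "\<dots> \<le> (1 - worst_loss S \<epsilon> K) ^ N" using q by (intro power_mono) auto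
  finally have qN: "1 - d \<le> (1 - worst_loss S \<epsilon> K) ^ N" .
  have lti: "integrable M (\<lambda>\<omega>. account (lti_policy K) \<epsilon> V\<^sub>0 (\<lambda>k. X k \<omega>) N)"
    "expectation (\<lambda>\<omega>. account (lti_policy K) \<epsilon> V\<^sub>0 (\<lambda>k. X k \<omega>) N) = V\<^sub>0 * (1 + drift K) ^ N"
    using expectation_account_lti[OF K \<open>V\<^sub>0 > 0\<close> order_refl] by auto
  have return_lti: "expectation (account_return (lti_policy K) \<epsilon> V\<^sub>0 N X) = (1 + drift K) ^ N - 1"
    unfolding account_return_def[abs_def] using lti \<open>V\<^sub>0 > 0\<close>
    by (simp add: prob_space diff_divide_distrib)
  have mod: "integrable M (\<lambda>\<omega>. account (modulated_policy d \<gamma>) \<epsilon> V\<^sub>0 (\<lambda>k. X k \<omega>) N)"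
    by (rule expectation_account_modulated(1)[OF assms(16) \<open>V\<^sub>0 > 0\<close>])
  have return_mod: "expectation (account_return (modulated_policy d \<gamma>) \<epsilon> V\<^sub>0 N X) = J 0 1 - 1"
    unfolding account_return_def[abs_def]
    using mod expectation_account_modulated(2)[OF assms(16) \<open>V\<^sub>0 > 0\<close>] \<open>V\<^sub>0 > 0\<close>
    by (simp add: prob_space diff_divide_distrib)
  have le: "(1 + drift K) ^ N \<le> J 0 1"
    using bellman_ge_lti[OF K, of 0 1] qN by simp
  have less: "(1 + drift K) ^ N < J 0 1" if "0 < drift K"
    using bellman_1_greater_lti[OF K that assms(6) qN, of 0] by simp
  show ?thesis
    unfolding return_lti return_mod using le less by (auto simp: net_return_def)
qed

end
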